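(* Let $[x_k]=(x_0,\dots,x_N)$ be a Gaussian sequence of $\mathbb{R}^d$-valued vectors. (i) $[x_k]$ is reciprocal if and only if both of the following hold: for every $k_1\in[0,N]$, the sequence $[y_k]_{k_1+1}^N$ with $y_k=[x_k',x_{k_1}']'$, $k\in[k_1+1,N]$, is Markov; and the sequence $[y_k]_0^{N-1}$ with $y_k=[x_k',x_N']'$, $k\in[0,N-1]$, is Markov. (ii) $[x_k]$ is reciprocal if and only if both of the following hold: for every $k_2\in[0,N]$, the sequence $[y_k]_0^{k_2-1}$ with $y_k=[x_k',x_{k_2}']'$, $k\in[0,k_2-1]$, is Markov; and the sequence $[y_k]_1^N$ with $y_k=[x_k',x_0']'$, $k\in[1,N]$, is Markov.
   Context: Sequences are indexed by discrete time $[0,N]=(0,1,\dots,N)$; $[x_k]_i^j=(x_i,\dots,x_j)$; the prime denotes transpose. A Gaussian sequence is jointly Gaussian, with possibly singular covariance. $F(\cdot|\cdot)$ denotes conditional CDF. A sequence $[y_k]_a^b$ is Markov iff conditioned on the state at any time $k$, the segment before $k$ is independent of the segment after $k$; equivalently $F(\eta_k|[y_i]_a^j)=F(\eta_k|y_j)$ (a.s.) for all $a\le j<k\le b$ and all $\eta_k$. By convention every sequence of length smaller than 3 (including the empty sequence) is Markov. $[x_k]$ is reciprocal iff conditioned on the states at any two times $j<l$, the segment inside $(j,l)$ is independent of the two segments outside $[j,l]$; equivalently, $F(\xi_k|[x_i]_0^j,[x_i]_l^N)=F(\xi_k|x_j,x_l)$ (a.s.) for all $j<k<l$ in $[0,N]$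 and all $\xi_k\in\mathbb{R}^d$. *)

theory Defs
  imports "HOL-Probability.Probability"
begin

text \<open>Degenerate (constant) variables count as Gaussian; this is what admits singular
  covariances below.\<close>

definition gaussian_rv :: "'s measure \<Rightarrow> ('s \<Rightarrow> real) \<Rightarrow> bool" where
  "gaussian_rv M X \<longleftrightarrow>
     X \<in> borel_measurable M \<and>
     (\<exists>\<mu>. (AE \<omega> in M. X \<omega> = \<mu>) \<or>
          (\<exists>\<sigma>>0. distributed M lborel X (\<lambda>t. ennreal (normal_density \<mu> \<sigma> t))))"

text \<open>Joint Gaussianity of \<open>(x\<^sub>0, \<dots>, x\<^sub>N)\<close>: every linear functional of the stacked vector is a
  scalar Gaussian.\<close>

definition gaussian_sequence ::
    "'s measure \<Rightarrow> (nat \<Rightarrow> 's \<Rightarrow> 'b::euclidean_space) \<Rightarrow> nat \<Rightarrow> bool" where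
  "gaussian_sequence M x N \<longleftrightarrow>
     (\<forall>k\<le>N. x k \<in> borel_measurable M) \<and>
     (\<forall>c. gaussian_rv M (\<lambda>\<omega>. \<Sum>k\<le>N. c k \<bullet> x k \<omega>))"

text \<open>The \<open>\<sigma>\<close>-algebra generated by \<open>(y\<^sub>i)\<close> for \<open>i \<in> I\<close>. It is the trivial one for
  \<open>I = {}\<close>, which a supremum of \<open>vimage_algebra\<close>s would not give (its space would be empty).\<close>

definition gen_algebra ::
    "'s measure \<Rightarrow> (nat \<Rightarrow> 's \<Rightarrow> 'b::topological_space) \<Rightarrow> nat set \<Rightarrow> 's measure" where
  "gen_algebra M y I = sigma (space M) (\<Union>i\<in>I. {y i -` A \<inter> space M | A. A \<in> sets borel})"

definition cond_indep_algebras ::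
    "'s measure \<Rightarrow> 's measure \<Rightarrow> 's measure \<Rightarrow> 's measure \<Rightarrow> bool" where
  "cond_indep_algebras M F G H \<longleftrightarrow>
     (\<forall>A\<in>sets F. \<forall>B\<in>sets G. AE \<omega> in M.
        real_cond_exp M H (indicator (A \<inter> B)) \<omega> =
        real_cond_exp M H (indicator A) \<omega> * real_cond_exp M H (indicator B) \<omega>)"

definition cond_indep_segments ::
    "'s measure \<Rightarrow> (nat \<Rightarrow> 's \<Rightarrow> 'b::topological_space) \<Rightarrow>
     nat set \<Rightarrow> nat set \<Rightarrow> nat set \<Rightarrow> bool" where
  "cond_indep_segments M y I J K \<longleftrightarrow>
     cond_indep_algebras M (gen_algebra M y I) (gen_algebra M y J) (gen_algebra M y K)"

text \<open>The time interval of a Markov sequence is given as a set of times, so that the empty interval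
  \<open>[0, -1]\<close> needs no truncated subtraction. Sequences of length less than 3 are
  automatically Markov, see \<open>markov_sequence_short\<close>.\<close>

definition markov_sequence ::
    "'s measure \<Rightarrow> (nat \<Rightarrow> 's \<Rightarrow> 'b::topological_space) \<Rightarrow> nat set \<Rightarrow> bool" where
  "markov_sequence M y I \<longleftrightarrow>
     (\<forall>k\<in>I. cond_indep_segments M y {i\<in>I. i < k} {i\<in>I. k < i} {k})"

definition reciprocal_sequence ::
    "'s measure \<Rightarrow> (nat \<Rightarrow> 's \<Rightarrow> 'b::topological_space) \<Rightarrow> nat \<Rightarrow> bool" where
  "reciprocal_sequence M x N \<longleftrightarrow>
     (\<forall>j l. j < l \<longrightarrow> l \<le> N \<longrightarrow>
        cond_indep_segments M x {j<..<l} ({..<j} \<union> {l<..N}) {j, l})"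

lemma subalgebra_gen_algebra:
  assumes "\<And>i. i \<in> I \<Longrightarrow> y i \<in> borel_measurable M"
  shows "subalgebra M (gen_algebra M y I)"
proof -
  have gen: "(\<Union>i\<in>I. {y i -` A \<inter> space M | A. A \<in> sets borel}) \<subseteq> sets M"
    using assms by (auto intro: measurable_sets)
  then have "(\<Union>i\<in>I. {y i -` A \<inter> space M | A. A \<in> sets borel}) \<subseteq> Pow (space M)"
    using sets.space_closed by blast
  then show ?thesis
    unfolding subalgebra_def gen_algebra_def
    using sets.sigma_sets_subset[OF gen] by (simp add: space_measure_of sets_measure_of)
qed

lemma gen_algebra_empty: "sets (gen_algebra M y {}) = {{}, space M}"
  by (simp add: gen_algebra_def sigma_sets_empty_eq)

lemma cond_indep_algebras_commute:
  "cond_indep_algebras M F G H \<longleftrightarrow> cond_indep_algebras M G F H"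
  unfolding cond_indep_algebras_def by (subst Int_commute, subst mult.commute) blast

lemma markov_sequence_short:
  assumes "prob_space M" and fin: "finite I" and short: "card I < 3"
    and meas: "\<And>i. i \<in> I \<Longrightarrow> y i \<in> borel_measurable M"
  shows "markov_sequence M y I"
proof -
  interpret prob_space M by fact
  have triv: "cond_indep_segments M y {} J {k}" if "k \<in> I" "J \<subseteq> I" for J k
  proof -
    let ?H = "gen_algebra M y {k}"
    have H: "subalgebra M ?H"
      by (rule subalgebra_gen_algebra) (use that meas in auto)
    interpret H: finite_measure_subalgebra M ?H
      by unfold_locales (rule H)
    have J: "subalgebra M (gen_algebra M y J)"
      by (rule subalgebra_gen_algebra) (use that meas in auto)
    have "space M \<in> sets ?H"
      using H sets.top[of ?H] by (simp add: subalgebra_def)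
    then have one: "AE \<omega> in M. real_cond_exp M ?H (indicator (space M)) \<omega> = indicator (space M) \<omega>"
      by (intro H.real_cond_exp_F_meas) (auto simp: emeasure_space_1)
    have zero: "AE \<omega> in M. real_cond_exp M ?H (indicator {}) \<omega> = indicator {} \<omega>"
      by (rule H.real_cond_exp_F_meas) auto
    have "AE \<omega> in M. real_cond_exp M ?H (indicator (A \<inter> B)) \<omega> =
        real_cond_exp M ?H (indicator A) \<omega> * real_cond_exp M ?H (indicator B) \<omega>"
      if "A \<in> {{}, space M}" "B \<in> sets (gen_algebra M y J)" for A B
    proof -
      have "B \<subseteq> space M"
        using J that(2) sets.sets_into_space unfolding subalgebra_def by blast
      then have B: "space M \<inter> B = B" by auto
      show ?thesis
      proof (cases "A = {}")
        case True
        then show ?thesis using zero by auto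
      next
        case False
        then have "A = space M" using that(1) by auto
        then show ?thesis using one by (auto simp: B)
      qed
    qed
    then show ?thesis
      unfolding cond_indep_segments_def cond_indep_algebras_def gen_algebra_empty by blast
  qed
  show ?thesis
    unfolding markov_sequence_def
  proof
    fix k assume k: "k \<in> I"
    have "{i\<in>I. i < k} = {} \<or> {i\<in>I. k < i} = {}"
    proof (rule ccontr)
      assume "\<not> ?thesis"
      then obtain a b where "a \<in> I" "a < k" "b \<in> I" "k < b" by auto
      then have "card {a, k, b} \<le> card I"
        by (intro card_mono fin) (use k in auto)
      moreover have "card {a, k, b} = 3" using \<open>a < k\<close> \<open>k < b\<close> by auto
      ultimately show False using short by simp
    qed
    then show "cond_indep_segments M y {i\<in>I. i < k} {i\<in>I. k < i} {k}"
    proof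
      assume e: "{i\<in>I. i < k} = {}"
      show ?thesis unfolding e by (rule triv[OF k]) auto
    next
      assume e: "{i\<in>I. k < i} = {}"
      have "cond_indep_segments M y {} {i\<in>I. i < k} {k}" using triv[OF k] by auto
      then show ?thesis
        unfolding e cond_indep_segments_def by (subst cond_indep_algebras_commute)
    qed
  qed
qed

end

theory Submission
  imports Defs
begin

text \<open>Write \<open>I \<bottom> J | K\<close> for the conditional independence of the segments \<open>I\<close> and \<open>J\<close> given \<open>K\<close>.
  It is equivalent to \<open>P(A | J \<union> K) = P(A | K)\<close> for all events \<open>A\<close> of \<open>I\<close>, which yields
  the semigraphoid axioms. Adjoining \<open>x\<^sub>c\<close> to every state means conditioning on
  \<open>c\<close> as well, so the Markov properties in (i) say that \<open>(j,l) \<bottom> (l,N] | {j,l}\<close>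
  for \<open>j < l \<le> N\<close> and \<open>[0,j) \<bottom> (j,N) | {j,N}\<close> for \<open>j < N\<close>. For \<open>l < N\<close>, weak union turns the latter into
  \<open>(j,l) \<bottom> [0,j) | {j,l} \<union> (l,N]\<close>, and contraction with the former gives
  \<open>(j,l) \<bottom> [0,j) \<union> (l,N] | {j,l}\<close>. Part (ii) is the same argument with time reversed.\<close>

section \<open>Conditional independence through conditional expectations\<close>

text \<open>Left to right, \<open>P(A | H)\<close> is already measurable for \<open>L\<close>, so it
  is a version of \<open>P(A | L)\<close> once its integrals agree with those of the indicator of
  \<open>A\<close> over all sets of \<open>L\<close>; a Dynkin argument reduces this to a generating
  system. Right to left, the tower property conditions \<open>L\<close> down to
  \<open>H\<close>.\<close>

lemma cond_indep_algebras_iff_real_cond_exp_eq: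
  assumes "finite_measure M"
    and F: "subalgebra M F" and G: "subalgebra M G" and H: "subalgebra M H" and L: "subalgebra M L"
    and gen: "sets L = sigma_sets (space M) (sets G \<union> sets H)"
  shows "cond_indep_algebras M F G H \<longleftrightarrow>
    (\<forall>A\<in>sets F. AE \<omega> in M. real_cond_exp M L (indicator A) \<omega> = real_cond_exp M H (indicator A) \<omega>)"
proof -
  interpret finite_measure M by fact
  interpret H: finite_measure_subalgebra M H by unfold_locales (rule H)
  interpret L: finite_measure_subalgebra M L by unfold_locales (rule L)
  have G_L: "sets G \<subseteq> sets L" and H_L: "sets H \<subseteq> sets L"
    unfolding gen by auto
  have HL: "subalgebra L H"
    using H L H_L by (auto simp: subalgebra_def)
  have F_M: "A \<in> sets M" if "A \<in> sets F" for A
    using that F by (auto simp: subalgebra_def)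
  have G_M: "A \<in> sets M" if "A \<in> sets G" for A
    using that G by (auto simp: subalgebra_def)
  have H_M: "A \<in> sets M" if "A \<in> sets H" for A
    using that H by (auto simp: subalgebra_def)
  have L_M: "A \<in> sets M" if "A \<in> sets L" for A
    using that L by (auto simp: subalgebra_def)
  have int_ind: "integrable M (indicator A :: _ \<Rightarrow> real)" if "A \<in> sets M" for A
    using that by (simp add: less_top[symmetric])
  \<comment> \<open>The factor \<open>P(A | H)\<close> comes out. Both directions use this to trade
    the product in the definition for a single conditional expectation given
    \<open>H\<close>.\<close>
  have pull_out: "AE \<omega> in M. real_cond_exp M H (\<lambda>\<omega>. indicator B \<omega> * real_cond_exp M H (indicator A) \<omega>) \<omega>
      = real_cond_exp M H (indicator A) \<omega> * real_cond_exp M H (indicator B) \<omega>"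
    if A: "A \<in> sets M" and B: "B \<in> sets M" for A B
  proof -
    have "integrable M (\<lambda>\<omega>. real_cond_exp M H (indicator A) \<omega> * indicator B \<omega>)"
      using integrable_mult_indicator[OF B H.real_cond_exp_int(1)[OF int_ind[OF A]]]
      by (simp add: mult.commute)
    then have "AE \<omega> in M. real_cond_exp M H (\<lambda>\<omega>. real_cond_exp M H (indicator A) \<omega> * indicator B \<omega>) \<omega>
      = real_cond_exp M H (indicator A) \<omega> * real_cond_exp M H (indicator B) \<omega>"
      using B by (intro H.real_cond_exp_mult) auto
    then show ?thesis by (simp add: mult.commute)
  qed
  show ?thesis
  proof
    assume CI: "cond_indep_algebras M F G H"
    show "\<forall>A\<in>sets F. AE \<omega> in M. real_cond_exp M L (indicator A) \<omega> = real_cond_exp M H (indicator A) \<omega>"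
    proof
      fix A assume A: "A \<in> sets F"
      let ?f = "indicator A :: _ \<Rightarrow> real" and ?g = "real_cond_exp M H (indicator A)"
      have f: "integrable M ?f" by (rule int_ind[OF F_M[OF A]])
      have g: "integrable M ?g" by (rule H.real_cond_exp_int(1)[OF f])
      have set_f: "set_integrable M C ?f" and set_g: "set_integrable M C ?g" if "C \<in> sets L" for C
        unfolding set_integrable_def
        by (rule integrable_mult_indicator[OF L_M[OF that] f], rule integrable_mult_indicator[OF L_M[OF that] g])
      \<comment> \<open>The union of \<open>sets G\<close> and \<open>sets H\<close> also generates
        \<open>L\<close>, but need not be closed under intersection; the system of all
        \<open>B \<inter> D\<close> is.\<close>
      let ?E = "{B \<inter> D | B D. B \<in> sets G \<and> D \<in> sets H}"
      have G_space: "space M \<in> sets G" and H_space: "space M \<in> sets H"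
        using G H sets.top[of G] sets.top[of H] by (auto simp: subalgebra_def)
      have E_L: "sets L = sigma_sets (space M) ?E"
      proof
        have "sets G \<union> sets H \<subseteq> ?E"
        proof
          fix C assume C: "C \<in> sets G \<union> sets H"
          then have "C \<inter> space M = C" "space M \<inter> C = C"
            using G_M H_M sets.sets_into_space by blast+
          then show "C \<in> ?E"
            using C G_space H_space by blast
        qed
        then show "sets L \<subseteq> sigma_sets (space M) ?E"
          unfolding gen by (rule sigma_sets_mono')
        have "?E \<subseteq> sets L" using G_L H_L by auto
        then have "sigma_sets (space L) ?E \<subseteq> sets L" by (rule sets.sigma_sets_subset)
        then show "sigma_sets (space M) ?E \<subseteq> sets L"
          using L by (simp add: subalgebra_def)
      qed
      have "Int_stable ?E"
      proof (rule Int_stableI)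
        fix a b assume "a \<in> ?E" "b \<in> ?E"
        then obtain B D B' D' where *: "a = B \<inter> D" "b = B' \<inter> D'"
          "B \<in> sets G" "D \<in> sets H" "B' \<in> sets G" "D' \<in> sets H" by auto
        then have "a \<inter> b = (B \<inter> B') \<inter> (D \<inter> D')" by auto
        then show "a \<inter> b \<in> ?E" using * by blast
      qed
      moreover have "?E \<subseteq> Pow (space M)"
        using G_M sets.sets_into_space by blast
      ultimately have "(LINT \<omega>:C|M. ?f \<omega>) = (LINT \<omega>:C|M. ?g \<omega>)" if "C \<in> sets L" for C
        using that unfolding E_L
      proof (induction rule: sigma_sets_induct_disjoint)
        case (basic C)
        then obtain B D where C: "C = B \<inter> D" and B: "B \<in> sets G" and D: "D \<in> sets H" by auto
        have AB: "A \<inter> B \<in> sets M" using F_M[OF A] G_M[OF B] by auto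
        have Bg: "integrable M (\<lambda>\<omega>. indicator B \<omega> * ?g \<omega>)"
          using integrable_mult_indicator[OF G_M[OF B] g] by simp
        have "AE \<omega> in M. real_cond_exp M H (indicator (A \<inter> B)) \<omega> =
            ?g \<omega> * real_cond_exp M H (indicator B) \<omega>"
          using CI A B unfolding cond_indep_algebras_def by blast
        with pull_out[OF F_M[OF A] G_M[OF B]]
        have eq: "AE \<omega> in M. real_cond_exp M H (indicator (A \<inter> B)) \<omega> =
            real_cond_exp M H (\<lambda>\<omega>. indicator B \<omega> * ?g \<omega>) \<omega>"
          by eventually_elim simp
        \<comment> \<open>\<open>B\<close> moves from the domain into the integrand. The remaining
          domain \<open>D\<close> lies in \<open>H\<close>, so integrands may be exchanged with
          their conditional expectations given \<open>H\<close>; after \<open>eq\<close>,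
          \<open>B\<close> moves back.\<close>
        have "(LINT \<omega>:C|M. ?f \<omega>) = (LINT \<omega>:D|M. indicator (A \<inter> B) \<omega>)"
          unfolding C set_lebesgue_integral_def
          by (intro Bochner_Integration.integral_cong) (auto simp: indicator_def)
        also have "\<dots> = (LINT \<omega>:D|M. real_cond_exp M H (indicator (A \<inter> B)) \<omega>)"
          by (rule H.real_cond_exp_intA[OF int_ind[OF AB] D])
        also have "\<dots> = (LINT \<omega>:D|M. real_cond_exp M H (\<lambda>\<omega>. indicator B \<omega> * ?g \<omega>) \<omega>)"
          using eq H_M[OF D] by (intro set_lebesgue_integral_cong_AE) auto
        also have "\<dots> = (LINT \<omega>:D|M. indicator B \<omega> * ?g \<omega>)"
          by (rule H.real_cond_exp_intA[OF Bg D, symmetric])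
        also have "\<dots> = (LINT \<omega>:C|M. ?g \<omega>)"
          unfolding C set_lebesgue_integral_def
          by (intro Bochner_Integration.integral_cong) (auto simp: indicator_def)
        finally show ?case .
      next
        case empty
        then show ?case by (simp add: set_lebesgue_integral_def)
      next
        case (compl C)
        then have C: "C \<in> sets L" by (simp add: E_L)
        have C': "space M - C \<in> sets L"
          using L C sets.compl_sets[of C L] by (auto simp: subalgebra_def)
        have un: "C \<union> (space M - C) = space M"
          using L_M[OF C] sets.sets_into_space by blast
        \<comment> \<open>The complement is reached by subtracting the integral over
          \<open>C\<close> from that over the whole space, on which both functions have the same
          integral.\<close>
        have split: "integral\<^sup>L M h = (LINT \<omega>:C|M. h \<omega>) + (LINT \<omega>:space M - C|M. h \<omega>)"
          if h: "integrable M h" "set_integrable M C h" "set_integrable M (space M - C) h"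
          for h :: "_ \<Rightarrow> real"
          using set_integral_Un[OF _ h(2,3)] set_integral_space[OF h(1)]
          unfolding un by simp
        have "integral\<^sup>L M ?f = integral\<^sup>L M ?g"
          by (rule H.real_cond_exp_int(2)[OF f, symmetric])
        then show ?case
          using compl.IH split[OF f set_f[OF C] set_f[OF C']] split[OF g set_g[OF C] set_g[OF C']]
          by simp
      next
        case (union C)
        then have C: "C i \<in> sets L" for i by (auto simp: E_L)
        then have UC: "(\<Union>i. C i) \<in> sets L" by auto
        have disj: "C i \<inter> C j = {}" if "i \<noteq> j" for i j
          using union.hyps(1) that by (auto simp: disjoint_family_on_def)
        have "(LINT \<omega>:(\<Union>i. C i)|M. h \<omega>) = (\<Sum>i. LINT \<omega>:C i|M. h \<omega>)"
          if "set_integrable M (\<Union>i. C i) h" for h :: "_ \<Rightarrow> real"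
          by (rule lebesgue_integral_countable_add) (use C L_M disj that in auto)
        from this[OF set_f[OF UC]] this[OF set_g[OF UC]] show ?case
          using union.IH by simp
      qed
      then show "AE \<omega> in M. real_cond_exp M L ?f \<omega> = ?g \<omega>"
        using f g measurable_from_subalg[OF HL borel_measurable_cond_exp]
        by (intro L.real_cond_exp_charact) auto
    qed
  next
    assume R: "\<forall>A\<in>sets F. AE \<omega> in M. real_cond_exp M L (indicator A) \<omega> = real_cond_exp M H (indicator A) \<omega>"
    show "cond_indep_algebras M F G H"
      unfolding cond_indep_algebras_def
    proof (intro ballI)
      fix A B assume A: "A \<in> sets F" and B: "B \<in> sets G"
      have AB: "integrable M (indicator (A \<inter> B) :: _ \<Rightarrow> real)"
        by (rule int_ind) (use F_M[OF A] G_M[OF B] in auto)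
      have ind: "(\<lambda>\<omega>. indicator B \<omega> * indicator A \<omega>) = (indicator (A \<inter> B) :: _ \<Rightarrow> real)"
        by (auto simp: indicator_def)
      \<comment> \<open>\<open>B\<close> belongs to \<open>L\<close>, so its indicator comes out of
        the conditional expectation given \<open>L\<close>, and \<open>R\<close> can replace what
        remains.\<close>
      have "AE \<omega> in M. real_cond_exp M L (\<lambda>\<omega>. indicator B \<omega> * indicator A \<omega>) \<omega> =
          indicator B \<omega> * real_cond_exp M L (indicator A) \<omega>"
        by (rule L.real_cond_exp_mult) (use AB B G_L F_M[OF A] in \<open>auto simp: ind\<close>)
      moreover note R[rule_format, OF A]
      ultimately have "AE \<omega> in M. real_cond_exp M L (indicator (A \<inter> B)) \<omega> =
          indicator B \<omega> * real_cond_exp M H (indicator A) \<omega>"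
        unfolding ind by eventually_elim simp
      then have "AE \<omega> in M. real_cond_exp M H (real_cond_exp M L (indicator (A \<inter> B))) \<omega> =
          real_cond_exp M H (\<lambda>\<omega>. indicator B \<omega> * real_cond_exp M H (indicator A) \<omega>) \<omega>"
        using G_M[OF B] by (intro H.real_cond_exp_cong) auto
      moreover have "AE \<omega> in M. real_cond_exp M H (real_cond_exp M L (indicator (A \<inter> B))) \<omega> =
          real_cond_exp M H (indicator (A \<inter> B)) \<omega>"
        by (rule H.real_cond_exp_nested_subalg[OF L HL AB])
      moreover note pull_out[OF F_M[OF A] G_M[OF B]]
      ultimately show "AE \<omega> in M. real_cond_exp M H (indicator (A \<inter> B)) \<omega> =
          real_cond_exp M H (indicator A) \<omega> * real_cond_exp M H (indicator B) \<omega>"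
        by eventually_elim simp
    qed
  qed
qed

section \<open>Generated sigma-algebras\<close>

lemma space_gen_algebra [simp]: "space (gen_algebra M y I) = space M"
  unfolding gen_algebra_def by (rule space_measure_of) auto

lemma sets_gen_algebra:
  "sets (gen_algebra M y I) =
    sigma_sets (space M) (\<Union>i\<in>I. {y i -` A \<inter> space M | A. A \<in> sets borel})"
  unfolding gen_algebra_def by (rule sets_measure_of) auto

lemma measurable_gen_algebra: "i \<in> I \<Longrightarrow> y i \<in> borel_measurable (gen_algebra M y I)"
  by (rule measurableI) (auto simp: sets_gen_algebra intro!: sigma_sets.Basic)

text \<open>Minimality of the generated algebra. With another generated algebra as \<open>N\<close>,
  inclusions reduce to measurability of the generating variables.\<close>

lemma sets_gen_algebra_subset:
  assumes "space N = space M" "\<And>i. i \<in> I \<Longrightarrow> y i \<in> borel_measurable N"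
  shows "sets (gen_algebra M y I) \<subseteq> sets N"
proof -
  have "(\<Union>i\<in>I. {y i -` A \<inter> space M | A. A \<in> sets borel}) \<subseteq> sets N"
    unfolding assms(1)[symmetric] using assms(2) by (auto intro: measurable_sets)
  then show ?thesis
    unfolding sets_gen_algebra assms(1)[symmetric] by (rule sets.sigma_sets_subset)
qed

lemma sets_gen_algebra_mono: "I \<subseteq> J \<Longrightarrow> sets (gen_algebra M y I) \<subseteq> sets (gen_algebra M y J)"
  by (rule sets_gen_algebra_subset) (auto intro: measurable_gen_algebra)

lemma sets_gen_algebra_Un:
  "sets (gen_algebra M y (I \<union> J)) =
    sigma_sets (space M) (sets (gen_algebra M y I) \<union> sets (gen_algebra M y J))"
proof
  show "sets (gen_algebra M y (I \<union> J)) \<subseteq>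
      sigma_sets (space M) (sets (gen_algebra M y I) \<union> sets (gen_algebra M y J))"
    unfolding sets_gen_algebra[of M y "I \<union> J"]
    by (rule sigma_sets_mono') (auto simp: sets_gen_algebra intro: sigma_sets.Basic)
  have "sets (gen_algebra M y I) \<union> sets (gen_algebra M y J) \<subseteq> sets (gen_algebra M y (I \<union> J))"
    by (intro Un_least sets_gen_algebra_mono) auto
  from sets.sigma_sets_subset[OF this]
  show "sigma_sets (space M) (sets (gen_algebra M y I) \<union> sets (gen_algebra M y J)) \<subseteq>
      sets (gen_algebra M y (I \<union> J))"
    by simp
qed

text \<open>A pair is measurable exactly when both components are; second countability makes the
  Borel algebra of the product the product of the Borel algebras. For empty \<open>I\<close> the
  left side is trivial and knows nothing of \<open>x c\<close>.\<close>

lemma gen_algebra_pair: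
  fixes x :: "nat \<Rightarrow> 's \<Rightarrow> 'b::second_countable_topology"
  assumes "I \<noteq> {}"
  shows "gen_algebra M (\<lambda>k \<omega>. (x k \<omega>, x c \<omega>)) I = gen_algebra M x (insert c I)"
    (is "gen_algebra M ?y I = _")
proof -
  have "sets (gen_algebra M ?y I) = sets (gen_algebra M x (insert c I))"
  proof
    show "sets (gen_algebra M ?y I) \<subseteq> sets (gen_algebra M x (insert c I))"
      by (rule sets_gen_algebra_subset)
        (auto intro!: borel_measurable_Pair measurable_gen_algebra)
    have "x i \<in> borel_measurable (gen_algebra M ?y I)" "x c \<in> borel_measurable (gen_algebra M ?y I)"
      if "i \<in> I" for i
    proof -
      have "?y i \<in> borel_measurable (gen_algebra M ?y I)"
        using that by (rule measurable_gen_algebra)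
      then have "?y i \<in> gen_algebra M ?y I \<rightarrow>\<^sub>M borel \<Otimes>\<^sub>M borel"
        by (simp add: borel_prod)
      from measurable_compose[OF this measurable_fst] measurable_compose[OF this measurable_snd]
      show "x i \<in> borel_measurable (gen_algebra M ?y I)"
        "x c \<in> borel_measurable (gen_algebra M ?y I)" by simp_all
    qed
    then show "sets (gen_algebra M x (insert c I)) \<subseteq> sets (gen_algebra M ?y I)"
      using assms by (intro sets_gen_algebra_subset) auto
  qed
  \<comment> \<open>\<open>sigma\<close> assigns measure zero to every set, so equal sets give equal
    measures, and one algebra can be rewritten into the other inside
    \<open>real_cond_exp\<close>.\<close>
  then show ?thesis
    by (rule measure_eqI) (simp only: gen_algebra_def emeasure_sigma)
qed

section \<open>Semigraphoid rules for segments\<close>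

text \<open>The sequence has a value at every natural number, but is measurable only at the times in
  \<open>T\<close>; hence the rules below ask for segments inside \<open>T\<close>.\<close>

locale random_family = finite_measure M for M :: "'s measure" +
  fixes x :: "nat \<Rightarrow> 's \<Rightarrow> 'b::topological_space" and T :: "nat set"
  assumes measurable_family: "i \<in> T \<Longrightarrow> x i \<in> borel_measurable M"
begin

lemma subalgebra_family: "I \<subseteq> T \<Longrightarrow> subalgebra M (gen_algebra M x I)"
  by (rule subalgebra_gen_algebra) (auto intro: measurable_family)

lemma cond_indep_segments_iff:
  assumes "I \<subseteq> T" "J \<subseteq> T" "K \<subseteq> T"
  shows "cond_indep_segments M x I J K \<longleftrightarrow> (\<forall>A\<in>sets (gen_algebra M x I). AE \<omega> in M.
    real_cond_exp M (gen_algebra M x (J \<union> K)) (indicator A) \<omega> =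
    real_cond_exp M (gen_algebra M x K) (indicator A) \<omega>)"
  unfolding cond_indep_segments_def
  by (intro cond_indep_algebras_iff_real_cond_exp_eq finite_measure_axioms subalgebra_family
      sets_gen_algebra_Un) (use assms in auto)

lemma cond_indep_segments_commute:
  "cond_indep_segments M x I J K \<longleftrightarrow> cond_indep_segments M x J I K"
  unfolding cond_indep_segments_def by (rule cond_indep_algebras_commute)

lemma cond_indep_segments_mono:
  assumes "cond_indep_segments M x I J K" "I' \<subseteq> I" "J' \<subseteq> J"
  shows "cond_indep_segments M x I' J' K"
  using assms(1) sets_gen_algebra_mono[OF assms(2), of M x] sets_gen_algebra_mono[OF assms(3), of M x]
  unfolding cond_indep_segments_def cond_indep_algebras_def by blast

text \<open>The criterion sees the second segment only through its union with \<open>K\<close>, so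
  adding \<open>K\<close> there changes nothing; symmetry does the same for the first
  segment.\<close>

lemma cond_indep_segments_absorb:
  assumes "I \<subseteq> T" "J \<subseteq> T" "K \<subseteq> T" "cond_indep_segments M x I J K"
  shows "cond_indep_segments M x (I \<union> K) (J \<union> K) K"
proof -
  have right: "cond_indep_segments M x I' (J' \<union> K) K"
    if "I' \<subseteq> T" "J' \<subseteq> T" "cond_indep_segments M x I' J' K" for I' J'
    using that assms(3) by (simp add: cond_indep_segments_iff Un_assoc)
  have "cond_indep_segments M x (J \<union> K) (I \<union> K) K"
    using assms right[of I J] right[of "J \<union> K" I] by (simp add: cond_indep_segments_commute)
  then show ?thesis by (simp add: cond_indep_segments_commute)
qed

text \<open>Given \<open>J \<union> J' \<union> K\<close> and given \<open>J' \<union> K\<close>,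
  the conditional probability of \<open>A\<close> is in both cases the one given \<open>K\<close>,
  the second time by monotonicity.\<close>

lemma cond_indep_segments_weak_union:
  assumes "I \<subseteq> T" "J \<union> J' \<subseteq> T" "K \<subseteq> T" "cond_indep_segments M x I (J \<union> J') K"
  shows "cond_indep_segments M x I J (J' \<union> K)"
proof -
  have "cond_indep_segments M x I J' K"
    using assms(4) by (rule cond_indep_segments_mono) auto
  then have "AE \<omega> in M. real_cond_exp M (gen_algebra M x (J \<union> (J' \<union> K))) (indicator A) \<omega> =
      real_cond_exp M (gen_algebra M x (J' \<union> K)) (indicator A) \<omega>"
    if A: "A \<in> sets (gen_algebra M x I)" for A
  proof -
    have "AE \<omega> in M. real_cond_exp M (gen_algebra M x (J \<union> (J' \<union> K))) (indicator A) \<omega> =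
        real_cond_exp M (gen_algebra M x K) (indicator A) \<omega>"
      using assms A by (simp add: cond_indep_segments_iff Un_assoc)
    moreover have "AE \<omega> in M. real_cond_exp M (gen_algebra M x (J' \<union> K)) (indicator A) \<omega> =
        real_cond_exp M (gen_algebra M x K) (indicator A) \<omega>"
      using assms A \<open>cond_indep_segments M x I J' K\<close> by (simp add: cond_indep_segments_iff)
    ultimately show ?thesis by eventually_elim simp
  qed
  then show ?thesis
    using assms by (simp add: cond_indep_segments_iff)
qed

text \<open>The condition shrinks in two stages, from \<open>J \<union> J' \<union> K\<close> to
  \<open>J' \<union> K\<close> and then to \<open>K\<close>, one hypothesis for each.\<close>

lemma cond_indep_segments_contraction:
  assumes "I \<subseteq> T" "J \<union> J' \<subseteq> T" "K \<subseteq> T"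
    and "cond_indep_segments M x I J (J' \<union> K)" "cond_indep_segments M x I J' K"
  shows "cond_indep_segments M x I (J \<union> J') K"
proof -
  have "AE \<omega> in M. real_cond_exp M (gen_algebra M x (J \<union> (J' \<union> K))) (indicator A) \<omega> =
      real_cond_exp M (gen_algebra M x K) (indicator A) \<omega>" if "A \<in> sets (gen_algebra M x I)" for A
  proof -
    have "AE \<omega> in M. real_cond_exp M (gen_algebra M x (J \<union> (J' \<union> K))) (indicator A) \<omega> =
        real_cond_exp M (gen_algebra M x (J' \<union> K)) (indicator A) \<omega>"
      using assms that by (simp add: cond_indep_segments_iff)
    moreover have "AE \<omega> in M. real_cond_exp M (gen_algebra M x (J' \<union> K)) (indicator A) \<omega> =
        real_cond_exp M (gen_algebra M x K) (indicator A) \<omega>"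
      using assms that by (simp add: cond_indep_segments_iff)
    ultimately show ?thesis by eventually_elim simp
  qed
  then show ?thesis
    using assms by (simp add: cond_indep_segments_iff Un_assoc)
qed

end

section \<open>Adjoining a fixed state\<close>

text \<open>Pairing adds \<open>c\<close> to the condition and to each nonempty segment.
  Monotonicity drops \<open>c\<close> from the segments, and absorption of the condition puts it
  back.\<close>

lemma cond_indep_segments_pair_iff:
  fixes x :: "nat \<Rightarrow> 's \<Rightarrow> 'b::second_countable_topology"
  assumes "finite_measure M" and meas: "\<And>i. i \<in> I \<union> J \<union> {k, c} \<Longrightarrow> x i \<in> borel_measurable M"
  shows "cond_indep_segments M (\<lambda>k \<omega>. (x k \<omega>, x c \<omega>)) I J {k} \<longleftrightarrow>
    cond_indep_segments M x I J {k, c}"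
proof -
  interpret finite_measure M by fact
  interpret random_family M x "I \<union> J \<union> {k, c}"
    by unfold_locales (rule meas)
  let ?y = "\<lambda>k \<omega>. (x k \<omega>, x c \<omega>)"
  \<comment> \<open>An empty segment of pairs generates the trivial algebra, so \<open>c\<close>
    must not be added to it.\<close>
  define aug where "aug S = (if S = {} then {} else insert c S)" for S :: "nat set"
  have aug: "gen_algebra M ?y S = gen_algebra M x (aug S)" for S
    by (cases "S = {}") (simp_all add: aug_def gen_algebra_pair, simp add: gen_algebra_def)
  have "gen_algebra M ?y {k} = gen_algebra M x {k, c}"
    by (simp add: aug aug_def insert_commute)
  then have "cond_indep_segments M ?y I J {k} \<longleftrightarrow> cond_indep_segments M x (aug I) (aug J) {k, c}"
    by (simp only: cond_indep_segments_def aug[of I] aug[of J])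
  also have "\<dots> \<longleftrightarrow> cond_indep_segments M x I J {k, c}"
  proof
    assume "cond_indep_segments M x (aug I) (aug J) {k, c}"
    then show "cond_indep_segments M x I J {k, c}"
      by (rule cond_indep_segments_mono) (auto simp: aug_def)
  next
    assume "cond_indep_segments M x I J {k, c}"
    then have "cond_indep_segments M x (I \<union> {k, c}) (J \<union> {k, c}) {k, c}"
      by (intro cond_indep_segments_absorb) auto
    then show "cond_indep_segments M x (aug I) (aug J) {k, c}"
      by (rule cond_indep_segments_mono) (auto simp: aug_def)
  qed
  finally show ?thesis .
qed

section \<open>Reciprocity from the Markov properties and back\<close>

theorem corollary4p3:
  fixes M :: "'s measure" and x :: "nat \<Rightarrow> 's \<Rightarrow> real ^ 'd" and N :: nat
  assumes "prob_space M"
    and "gaussian_sequence M x N"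
  shows "(reciprocal_sequence M x N \<longleftrightarrow>
            (\<forall>k1\<le>N. markov_sequence M (\<lambda>k \<omega>. (x k \<omega>, x k1 \<omega>)) {k1<..N}) \<and>
            markov_sequence M (\<lambda>k \<omega>. (x k \<omega>, x N \<omega>)) {..<N})
       \<and> (reciprocal_sequence M x N \<longleftrightarrow>
            (\<forall>k2\<le>N. markov_sequence M (\<lambda>k \<omega>. (x k \<omega>, x k2 \<omega>)) {..<k2}) \<and>
            markov_sequence M (\<lambda>k \<omega>. (x k \<omega>, x 0 \<omega>)) {0<..N})"
proof -
  interpret prob_space M by fact
  interpret random_family M x "{..N}"
    using assms(2) by unfold_locales (simp add: gaussian_sequence_def)
  let ?CI = "cond_indep_segments M x"
  have pair_iff: "cond_indep_segments M (\<lambda>k \<omega>. (x k \<omega>, x c \<omega>)) I J {k} \<longleftrightarrow> ?CI I J {k, c}"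
    if "I \<union> J \<union> {k, c} \<subseteq> {..N}" for I J k c
    by (rule cond_indep_segments_pair_iff[OF finite_measure_axioms measurable_family]) (use that in blast)
  have right_iff: "markov_sequence M (\<lambda>k \<omega>. (x k \<omega>, x j \<omega>)) {j<..N} \<longleftrightarrow>
      (\<forall>l. j < l \<longrightarrow> l \<le> N \<longrightarrow> ?CI {j<..<l} {l<..N} {j, l})" if "j \<le> N" for j
  proof -
    have "cond_indep_segments M (\<lambda>k \<omega>. (x k \<omega>, x j \<omega>)) {i\<in>{j<..N}. i < l} {i\<in>{j<..N}. l < i} {l} \<longleftrightarrow>
        ?CI {j<..<l} {l<..N} {j, l}" if "j < l" "l \<le> N" for l
    proof -
      have "{i\<in>{j<..N}. i < l} = {j<..<l}" "{i\<in>{j<..N}. l < i} = {l<..N}"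
        using that by auto
      moreover have "{j, l} = {l, j}" by auto
      ultimately show ?thesis
        using pair_iff[of "{j<..<l}" "{l<..N}" l j] that by auto
    qed
    then show ?thesis by (auto simp: markov_sequence_def)
  qed
  have left_iff: "markov_sequence M (\<lambda>k \<omega>. (x k \<omega>, x l \<omega>)) {..<l} \<longleftrightarrow>
      (\<forall>j<l. ?CI {..<j} {j<..<l} {j, l})" if "l \<le> N" for l
  proof -
    have "cond_indep_segments M (\<lambda>k \<omega>. (x k \<omega>, x l \<omega>)) {i\<in>{..<l}. i < j} {i\<in>{..<l}. j < i} {j} \<longleftrightarrow>
        ?CI {..<j} {j<..<l} {j, l}" if "j < l" for j
    proof -
      have eqs: "{i\<in>{..<l}. i < j} = {..<j}" "{i\<in>{..<l}. j < i} = {j<..<l}"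
        using that by auto
      show ?thesis
        unfolding eqs by (rule pair_iff) (use that \<open>l \<le> N\<close> in auto)
    qed
    then show ?thesis by (auto simp: markov_sequence_def)
  qed
  \<comment> \<open>Each Markov condition is reciprocity with one of the two outer segments
    dropped.\<close>
  have right: "?CI {j<..<l} {l<..N} {j, l}" and left: "?CI {..<j} {j<..<l} {j, l}"
    if R: "reciprocal_sequence M x N" and "j < l" "l \<le> N" for j l
  proof -
    have *: "?CI {j<..<l} ({..<j} \<union> {l<..N}) {j, l}"
      using that by (simp add: reciprocal_sequence_def)
    show "?CI {j<..<l} {l<..N} {j, l}"
      by (rule cond_indep_segments_mono[OF *]) auto
    have "?CI {j<..<l} {..<j} {j, l}"
      by (rule cond_indep_segments_mono[OF *]) auto
    then show "?CI {..<j} {j<..<l} {j, l}"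
      by (simp add: cond_indep_segments_commute)
  qed
  have recip_from_right: "reciprocal_sequence M x N"
    if A: "\<And>j l. j < l \<Longrightarrow> l \<le> N \<Longrightarrow> ?CI {j<..<l} {l<..N} {j, l}"
      and B: "\<And>j. j < N \<Longrightarrow> ?CI {..<j} {j<..<N} {j, N}"
    unfolding reciprocal_sequence_def
  proof (intro allI impI)
    fix j l assume jl: "j < l" "l \<le> N"
    show "?CI {j<..<l} ({..<j} \<union> {l<..N}) {j, l}"
    proof (cases "l = N")
      case True
      then show ?thesis
        using B[of j] jl by (simp add: cond_indep_segments_commute)
    next
      case False
      \<comment> \<open>The part \<open>{l..<N}\<close> is moved into the condition. It contains
        \<open>l\<close>, and the old condition supplies \<open>j\<close> and \<open>N\<close>, so
        the new one is exactly \<open>{j, l}\<close> with the whole future of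
        \<open>l\<close>.\<close>
      have eqs: "{j<..<N} = {j<..<l} \<union> {l..<N}" "{l..<N} \<union> {j, N} = {l<..N} \<union> {j, l}"
        using jl False by auto
      have "?CI {..<j} {j<..<N} {j, N}"
        using B[of j] jl by simp
      then have "?CI {..<j} {j<..<l} ({l..<N} \<union> {j, N})"
        unfolding eqs(1) by (intro cond_indep_segments_weak_union) (use jl in auto)
      then have "?CI {..<j} {j<..<l} ({l<..N} \<union> {j, l})"
        unfolding eqs(2) .
      then have "?CI {j<..<l} {..<j} ({l<..N} \<union> {j, l})"
        by (simp only: cond_indep_segments_commute)
      \<comment> \<open>\<open>A\<close> removes \<open>{l<..N}\<close> from the condition and
        returns it as an outer segment.\<close>
      then show ?thesis
        using A[OF jl] jl by (intro cond_indep_segments_contraction) auto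
    qed
  qed
  have recip_from_left: "reciprocal_sequence M x N"
    if C: "\<And>j l. j < l \<Longrightarrow> l \<le> N \<Longrightarrow> ?CI {..<j} {j<..<l} {j, l}"
      and D: "\<And>l. 0 < l \<Longrightarrow> l \<le> N \<Longrightarrow> ?CI {0<..<l} {l<..N} {0, l}"
    unfolding reciprocal_sequence_def
  proof (intro allI impI)
    fix j l assume jl: "j < l" "l \<le> N"
    show "?CI {j<..<l} ({..<j} \<union> {l<..N}) {j, l}"
    proof (cases "j = 0")
      case True
      then show ?thesis using D[of l] jl by simp
    next
      case False
      \<comment> \<open>Mirror image with anchor \<open>0\<close>: the part \<open>{0<..j}\<close>
        moved into the condition contains \<open>j\<close>, and the old condition supplies
        \<open>0\<close> and \<open>l\<close>.\<close>
      have eqs: "{0<..<l} = {j<..<l} \<union> {0<..j}" "{0<..j} \<union> {0, l} = {..<j} \<union> {j, l}"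
        using jl False by auto
      \<comment> \<open>Weak union splits the second segment, so the segment to be split has to
        stand there.\<close>
      have "?CI {l<..N} {0<..<l} {0, l}"
        using D[of l] jl by (simp only: cond_indep_segments_commute)
      then have "?CI {l<..N} {j<..<l} ({0<..j} \<union> {0, l})"
        unfolding eqs(1) by (intro cond_indep_segments_weak_union) (use jl in auto)
      then have "?CI {l<..N} {j<..<l} ({..<j} \<union> {j, l})"
        unfolding eqs(2) .
      then have "?CI {j<..<l} {l<..N} ({..<j} \<union> {j, l})"
        by (simp only: cond_indep_segments_commute)
      moreover have "?CI {j<..<l} {..<j} {j, l}"
        using C[OF jl] by (simp only: cond_indep_segments_commute)
      ultimately have "?CI {j<..<l} ({l<..N} \<union> {..<j}) {j, l}"
        using jl by (intro cond_indep_segments_contraction) auto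
      then show ?thesis by (simp only: Un_commute)
    qed
  qed
  show ?thesis
  proof (intro conjI iffI allI impI)
    \<comment> \<open>This direction serves both equivalences; the sequences anchored at
      \<open>N\<close> and at \<open>0\<close> are instances of \<open>left\<close> and
      \<open>right\<close>.\<close>
    assume R: "reciprocal_sequence M x N"
    show "markov_sequence M (\<lambda>k \<omega>. (x k \<omega>, x k1 \<omega>)) {k1<..N}" if "k1 \<le> N" for k1
      using right[OF R] right_iff[OF that] by blast
    show "markov_sequence M (\<lambda>k \<omega>. (x k \<omega>, x k2 \<omega>)) {..<k2}" if "k2 \<le> N" for k2
      using left[OF R _ that] left_iff[OF that] by blast
    show "markov_sequence M (\<lambda>k \<omega>. (x k \<omega>, x N \<omega>)) {..<N}"
      using left[OF R] left_iff[of N] by blast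
    show "markov_sequence M (\<lambda>k \<omega>. (x k \<omega>, x 0 \<omega>)) {0<..N}"
      using right[OF R] right_iff[of 0] by blast
  next
    assume AB: "(\<forall>k1\<le>N. markov_sequence M (\<lambda>k \<omega>. (x k \<omega>, x k1 \<omega>)) {k1<..N}) \<and>
      markov_sequence M (\<lambda>k \<omega>. (x k \<omega>, x N \<omega>)) {..<N}"
    show "reciprocal_sequence M x N"
    proof (rule recip_from_right)
      show "?CI {j<..<l} {l<..N} {j, l}" if "j < l" "l \<le> N" for j l
        using AB right_iff[of j] that by simp
      show "?CI {..<j} {j<..<N} {j, N}" if "j < N" for j
        using AB left_iff[of N] that by blast
    qed
  next
    assume CD: "(\<forall>k2\<le>N. markov_sequence M (\<lambda>k \<omega>. (x k \<omega>, x k2 \<omega>)) {..<k2}) \<and>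
      markov_sequence M (\<lambda>k \<omega>. (x k \<omega>, x 0 \<omega>)) {0<..N}"
    show "reciprocal_sequence M x N"
    proof (rule recip_from_left)
      show "?CI {..<j} {j<..<l} {j, l}" if "j < l" "l \<le> N" for j l
        using CD left_iff[of l] that by blast
      show "?CI {0<..<l} {l<..N} {0, l}" if "0 < l" "l \<le> N" for l
        using CD right_iff[of 0] that by blast
    qed
  qed
qed

end
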